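(* Let $\bar T>0$ be given and assume that there exist a bounded continuously differentiable matrix-valued function $S:[0,\bar T]\times\mathcal{P}\to\mathbb{S}^n_{\succ0}$ and a scalar $\varepsilon>0$ such that $$\partial_\rho S(\bar T,\theta)\mu+\mathrm{Sym}[S(\bar T,\theta)A(\theta)]+\varepsilon I_n\preceq0,$$ $$\partial_\tau S(\tau,\theta)+\partial_\rho S(\tau,\theta)\mu+\mathrm{Sym}[S(\tau,\theta)A(\theta)]+\varepsilon I_n\preceq0$$ and $$S(0,\theta)-S(\bar T,\eta)\preceq0$$ hold for all $\theta,\eta\in\mathcal{P}$, all $\mu\in\mathcal{D}^v$ and all $\tau\in[0,\bar T]$. Then the LPV system $\dot x(t)=A(\rho(t))x(t)$, $x(0)=x_0$, with parameter trajectories $\rho\in\mathscr{P}_{\geqslant\bar T}$ is asymptotically stable.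
   Context: Notation: $\mathbb{S}^n$ is the set of real symmetric $n\times n$ matrices, $\mathbb{S}^n_{\succ0}$ the positive definite ones; $A\preceq B$ means that $B-A$ is positive semidefinite; $\mathrm{Sym}[M]:=M+M^T$; $I_n$ is the identity matrix; $\mathbb{N}_0$ is the set of nonnegative integers. Setting: $\mathcal{P}=\mathcal{P}_1\times\dots\times\mathcal{P}_N\subset\mathbb{R}^N$ with $\mathcal{P}_i=[\underline\rho_i,\bar\rho_i]$, $\underline\rho_i\le\bar\rho_i$; $\mathcal{D}=\mathcal{D}_1\times\dots\times\mathcal{D}_N$ with $\mathcal{D}_i=[\underline\nu_i,\bar\nu_i]$, $\underline\nu_i\le\bar\nu_i$; $\mathcal{D}^v=\{\underline\nu_1,\bar\nu_1\}\times\dots\times\{\underline\nu_N,\bar\nu_N\}$ is the set of vertices of $\mathcal{D}$. The function $A:\mathcal{P}\to\mathbb{R}^{n\times n}$ is bounded and continuous. For $S=S(\tau,\rho)$, $\partial_\tau S$ is the partial derivative with respect to the first argument and $\partial_\rho S(\tau,\theta)\mu:=\sum_{i=1}^N\mu_i\,\partial_{\rho_i}S(\tau,\theta)$. Derivatives at the boundary of $[0,\bar T]\times\mathcal{P}$ are one-sided, and $\partial_{\rho_i}S:=0$ if $\underline\rho_i=\bar\rho_i$. For $\rho\in\mathcal{P}$, $\mathcal{Q}(\rho)=\mathcal{Q}_1(\rho)\times\dots\times\mathcal{Q}_N(\rho)$, where $\mathcal{Q}_i(\rho)=\mathcal{D}_i$ if $\rho_i\in(\underline\rho_i,\bar\rho_i)$,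 $\mathcal{Q}_i(\rho)=\mathcal{D}_i\cap\mathbb{R}_{\ge0}$ if $\rho_i=\underline\rho_i$, and $\mathcal{Q}_i(\rho)=\mathcal{D}_i\cap\mathbb{R}_{\le0}$ if $\rho_i=\bar\rho_i$. $\mathscr{P}_{\geqslant\bar T}$ is the set of piecewise differentiable, left-continuous functions $\rho:\mathbb{R}_{\ge0}\to\mathcal{P}$ for which there is a sequence $0=t_0<t_1<t_2<\dots$ with $t_{k+1}-t_k\ge\bar T$ for all $k\in\mathbb{N}_0$ such that $\rho$ is differentiable with $\dot\rho(t)\in\mathcal{Q}(\rho(t))$ for all $t\in(t_k,t_{k+1})$ and all $k\in\mathbb{N}_0$. Jumps of $\rho$ to arbitrary values in $\mathcal{P}$ may occur only at the times $t_k$, $k\ge1$ (no discontinuity occurs at $t_0=0$). Solutions $x$ are continuous on $\mathbb{R}_{\ge0}$ and satisfy $\dot x(t)=A(\rho(t))x(t)$ for all $t\notin\{t_k\}$. The LPV system with parameter trajectories in a family $\mathscr{P}$ is asymptotically stable if $x=0$ is globally asymptotically stable uniformly over the family: (i) there is a class-$\mathcal{K}_\infty$ function $\alpha$ with $|x(t)|\le\alpha(|x_0|)$ for all $t\ge0$, $x_0\in\mathbb{R}^n$, $\rho\in\mathscr{P}$; and (ii) for all $r,\epsilon>0$ there is $t^*\ge 0$ such that $|x_0|\le r$, $\rho\in\mathscr{P}$ and $t\ge t^*$ imply $|x(t)|\le\epsilon$. *)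

theory Defs
  imports "HOL-Analysis.Analysis"
begin

definition plus_transpose :: "real^'n^'n \<Rightarrow> real^'n^'n"  (\<open>Sym\<close>)
  where "Sym M = M + transpose M"

definition pos_semidef :: "real^'n^'n \<Rightarrow> bool"
  where "pos_semidef M \<longleftrightarrow> transpose M = M \<and> (\<forall>x. 0 \<le> x \<bullet> (M *v x))"

definition pos_def :: "real^'n^'n \<Rightarrow> bool"
  where "pos_def M \<longleftrightarrow> transpose M = M \<and> (\<forall>x. x \<noteq> 0 \<longrightarrow> 0 < x \<bullet> (M *v x))"

definition loewner_le :: "real^'n^'n \<Rightarrow> real^'n^'n \<Rightarrow> bool"  (infix \<open>\<preceq>\<close> 50)
  where "M \<preceq> M' \<longleftrightarrow> pos_semidef (M' - M)"

text \<open>Continuous differentiability on a set that need not be open: Frechet differentiability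
  relative to the set (hence one-sided at boundary points) with a derivative that can be chosen
  continuous.  On a set without interior the relative derivative is not unique, so a selection is
  required to exist.  On a box \<^term>\<open>cbox a b\<close> this is equivalent to existence and continuity of the
  (one-sided) partial derivatives in all coordinates \<open>i\<close> with \<open>a$i < b$i\<close>.\<close>

definition continuously_differentiable_on ::
    "('a::real_normed_vector \<Rightarrow> 'b::real_normed_vector) \<Rightarrow> 'a set \<Rightarrow> bool"
  where "continuously_differentiable_on f X \<longleftrightarrow>
    (\<exists>f' :: 'a \<Rightarrow> 'a \<Rightarrow>\<^sub>L 'b.
       (\<forall>p\<in>X. (f has_derivative blinfun_apply (f' p)) (at p within X)) \<and> continuous_on X f')"

definition partial_tau ::
    "real \<Rightarrow> (real \<Rightarrow> real^'p \<Rightarrow> real^'n^'n) \<Rightarrow> real \<Rightarrow> real^'p \<Rightarrow> real^'n^'n"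
  where "partial_tau T S \<tau> \<theta> = vector_derivative (\<lambda>s. S s \<theta>) (at \<tau> within {0..T})"

definition partial_rho ::
    "real^'p \<Rightarrow> real^'p \<Rightarrow> (real \<Rightarrow> real^'p \<Rightarrow> real^'n^'n) \<Rightarrow> 'p \<Rightarrow> real \<Rightarrow> real^'p \<Rightarrow> real^'n^'n"
  where "partial_rho lo hi S i \<tau> \<theta> =
    (if lo$i = hi$i then 0
     else vector_derivative (\<lambda>s. S \<tau> (\<chi> j. if j = i then s else \<theta>$j))
            (at (\<theta>$i) within {lo$i..hi$i}))"

definition dir_partial_rho ::
    "real^'p \<Rightarrow> real^'p \<Rightarrow> (real \<Rightarrow> real^'p \<Rightarrow> real^'n^'n) \<Rightarrow> real \<Rightarrow> real^'p \<Rightarrow> real^'p \<Rightarrow> real^'n^'n"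
  where "dir_partial_rho lo hi S \<tau> \<theta> \<mu> = (\<Sum>i\<in>UNIV. \<mu>$i *\<^sub>R partial_rho lo hi S i \<tau> \<theta>)"

definition box_vertices :: "real^'p \<Rightarrow> real^'p \<Rightarrow> (real^'p) set"
  where "box_vertices a b = {\<mu>. \<forall>i. \<mu>$i = a$i \<or> \<mu>$i = b$i}"

text \<open>The admissible rates at \<open>\<theta> \<in> cbox lo hi\<close>.  If \<open>lo$i = hi$i\<close>, both boundary conditions
  apply; this is no restriction, as the \<open>i\<close>-th component of a trajectory is then constant and has
  derivative zero.\<close>

definition rate_set ::
    "real^'p \<Rightarrow> real^'p \<Rightarrow> real^'p \<Rightarrow> real^'p \<Rightarrow> real^'p \<Rightarrow> (real^'p) set"
  where "rate_set lo hi \<nu>lo \<nu>hi \<theta> =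
    {\<mu> \<in> cbox \<nu>lo \<nu>hi. \<forall>i. (\<theta>$i = lo$i \<longrightarrow> 0 \<le> \<mu>$i) \<and> (\<theta>$i = hi$i \<longrightarrow> \<mu>$i \<le> 0)}"

text \<open>Functions on the half-line \<open>[0, \<infinity>)\<close> are represented by total functions whose
  values at negative arguments are irrelevant.  Left-continuity is required at positive times, and
  right-continuity at zero excludes a jump there.\<close>

definition has_switching_times ::
    "real \<Rightarrow> real^'p \<Rightarrow> real^'p \<Rightarrow> real^'p \<Rightarrow> real^'p \<Rightarrow> (real \<Rightarrow> real^'p) \<Rightarrow> (nat \<Rightarrow> real) \<Rightarrow> bool"
  where "has_switching_times T lo hi \<nu>lo \<nu>hi \<rho> t \<longleftrightarrow>
    t 0 = 0 \<and> strict_mono t \<and> (\<forall>k. T \<le> t (Suc k) - t k) \<and>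
    (\<forall>s\<ge>0. \<rho> s \<in> cbox lo hi) \<and>
    (\<forall>s>0. continuous (at_left s) \<rho>) \<and> continuous (at_right 0) \<rho> \<and>
    (\<forall>k. \<forall>s\<in>{t k<..<t (Suc k)}.
       \<exists>d\<in>rate_set lo hi \<nu>lo \<nu>hi (\<rho> s). (\<rho> has_vector_derivative d) (at s))"

definition dwell_time_trajectories ::
    "real \<Rightarrow> real^'p \<Rightarrow> real^'p \<Rightarrow> real^'p \<Rightarrow> real^'p \<Rightarrow> (real \<Rightarrow> real^'p) set"
  where "dwell_time_trajectories T lo hi \<nu>lo \<nu>hi = {\<rho>. \<exists>t. has_switching_times T lo hi \<nu>lo \<nu>hi \<rho> t}"

text \<open>The relation \<open>sw\<close> tells which sequences of switching times belong to a trajectory; the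
  differential equation is imposed off such a sequence.\<close>

definition lpv_solution ::
    "(real^'p \<Rightarrow> real^'n^'n) \<Rightarrow> ((real \<Rightarrow> real^'p) \<Rightarrow> (nat \<Rightarrow> real) \<Rightarrow> bool) \<Rightarrow>
     (real \<Rightarrow> real^'p) \<Rightarrow> real^'n \<Rightarrow> (real \<Rightarrow> real^'n) \<Rightarrow> bool"
  where "lpv_solution A sw \<rho> x0 x \<longleftrightarrow>
    x 0 = x0 \<and> continuous_on {0..} x \<and>
    (\<exists>t. sw \<rho> t \<and>
      (\<forall>s\<ge>0. s \<notin> range t \<longrightarrow> (x has_vector_derivative A (\<rho> s) *v x s) (at s)))"

definition class_K_infinity :: "(real \<Rightarrow> real) \<Rightarrow> bool"
  where "class_K_infinity \<alpha> \<longleftrightarrow>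
    continuous_on {0..} \<alpha> \<and> strict_mono_on {0..} \<alpha> \<and> \<alpha> 0 = 0 \<and> filterlim \<alpha> at_top at_top"

definition lpv_asymptotically_stable ::
    "(real^'p \<Rightarrow> real^'n^'n) \<Rightarrow> ((real \<Rightarrow> real^'p) \<Rightarrow> (nat \<Rightarrow> real) \<Rightarrow> bool) \<Rightarrow>
     (real \<Rightarrow> real^'p) set \<Rightarrow> bool"
  where "lpv_asymptotically_stable A sw F \<longleftrightarrow>
    (\<exists>\<alpha>. class_K_infinity \<alpha> \<and>
      (\<forall>\<rho>\<in>F. \<forall>x0 x. lpv_solution A sw \<rho> x0 x \<longrightarrow> (\<forall>t\<ge>0. norm (x t) \<le> \<alpha> (norm x0)))) \<and>
    (\<forall>r>0. \<forall>\<epsilon>>0. \<exists>tstar\<ge>0.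
      \<forall>\<rho>\<in>F. \<forall>x0 x. norm x0 \<le> r \<longrightarrow> lpv_solution A sw \<rho> x0 x \<longrightarrow>
        (\<forall>t\<ge>tstar. norm (x t) \<le> \<epsilon>))"

end

theory Submission
  imports Defs
begin

text \<open>
  The matrix function \<open>S\<close> yields a Lyapunov function that carries a timer.  For a trajectory \<open>\<rho>\<close> with
  switching times \<open>t k\<close> and a solution \<open>x\<close>, let \<open>V s = x s \<bullet> (S (min (s - t k) T) (\<rho> s) *v x s)\<close> for
  \<open>s \<in> {t k<..t (Suc k)}\<close>: the timer runs until the minimal dwell time has elapsed and then stays at
  \<open>T\<close> until the next jump.  By the chain rule the derivative of \<open>V\<close> is the quadratic form of
  \<open>\<partial>\<^sub>\<tau>S + \<partial>\<^sub>\<rho>S \<mu> + Sym (S A)\<close> while the timer runs, and the same without \<open>\<partial>\<^sub>\<tau>S\<close> afterwards, where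
  \<open>\<mu>\<close> is the rate of \<open>\<rho>\<close>.  These expressions are affine in \<open>\<mu>\<close>, so the two matrix inequalities at
  the vertices of the rate box bound them on the whole box, by \<open>- \<epsilon> |x|\<^sup>2\<close>
  (\<open>dir_partial_rho_le_vertex\<close>, \<open>quad_rate_le\<close>).

  By compactness there are constants \<open>0 < c\<close> and \<open>0 < C\<close> with \<open>c |x|\<^sup>2 \<le> V \<le> C |x|\<^sup>2\<close>.  Hence
  \<open>V' \<le> - (\<epsilon> / C) V\<close>, that is, \<open>exp (\<epsilon> / C * s) * V s\<close> does not increase between jumps
  (\<open>weighted_quad_decreasing\<close>).  At a jump the timer has reached \<open>T\<close> and is reset to \<open>0\<close>;
  the condition \<open>S 0 \<theta> \<preceq> S T \<eta>\<close> says that \<open>V\<close> does not increase there either, whatever the new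
  parameter value is (\<open>decay_on_dwell_interval\<close>).  Chaining the intervals gives
  \<open>|x s| \<le> sqrt (C / c) * exp (- (\<epsilon> / (2 * C)) * s) * |x 0|\<close> with constants independent of the
  trajectory (\<open>solution_decays_exponentially\<close>), which is uniform asymptotic stability.
\<close>

section \<open>Quadratic forms of matrices\<close>

definition quad :: "real^'n^'n \<Rightarrow> real^'n \<Rightarrow> real"
  where "quad M x = x \<bullet> (M *v x)"

lemma bounded_bilinear_matrix_vector_mult:
  "bounded_bilinear ((*v) :: real^'n^'m \<Rightarrow> real^'n \<Rightarrow> real^'m)"
  unfolding bilinear_conv_bounded_bilinear[symmetric]
  by (auto simp: bilinear_def intro!: linearI
      simp: matrix_vector_right_distrib matrix_vector_mult_add_rdistrib
        scaleR_matrix_vector_assoc matrix_vector_mult_scaleR)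

lemmas continuous_on_matrix_vector_mult [continuous_intros] =
  bounded_bilinear.continuous_on[OF bounded_bilinear_matrix_vector_mult]

lemmas tendsto_matrix_vector_mult [tendsto_intros] =
  bounded_bilinear.tendsto[OF bounded_bilinear_matrix_vector_mult]

lemma quad_add: "quad (M + M') x = quad M x + quad M' x"
  by (simp add: quad_def matrix_vector_mult_add_rdistrib inner_add_right)

lemma quad_diff: "quad (M - M') x = quad M x - quad M' x"
  by (simp add: quad_def matrix_vector_mult_diff_rdistrib inner_diff_right)

lemma quad_scaleR: "quad (c *\<^sub>R M) x = c * quad M x"
  by (simp add: quad_def scaleR_matrix_vector_assoc[symmetric])

lemma quad_zero: "quad 0 x = 0"
  by (simp add: quad_def)

lemma quad_sum: "quad (\<Sum>i\<in>I. M i) x = (\<Sum>i\<in>I. quad (M i) x)"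
  by (induction I rule: infinite_finite_induct) (auto simp: quad_zero quad_add)

lemma quad_mat_1: "quad (mat 1) x = (norm x)\<^sup>2"
  by (simp add: quad_def power2_norm_eq_inner)

lemma inner_transpose_matrix_vector:
  fixes M :: "real^'n^'m"
  shows "x \<bullet> (transpose M *v y) = (M *v x) \<bullet> y"
  by (metis dot_lmul_matrix inner_commute transpose_matrix_vector)

lemma quad_Sym: "quad (Sym M) x = 2 * quad M x"
  by (simp only: plus_transpose_def quad_add)
     (simp add: quad_def inner_transpose_matrix_vector inner_commute del: transpose_matrix_vector)

lemma loewner_le_0_imp_quad_le_0: "M \<preceq> 0 \<Longrightarrow> quad M x \<le> 0"
  unfolding loewner_le_def pos_semidef_def quad_def[symmetric]
  by (simp only: quad_diff quad_zero) auto

lemma bounded_imp_quad_bound: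
  assumes "bounded (\<M> :: (real^'n^'n) set)"
  shows "\<exists>C>0. \<forall>M\<in>\<M>. \<forall>x. quad M x \<le> C * (norm x)\<^sup>2"
proof -
  obtain K where K: "K > 0" "\<And>(M::real^'n^'n) x. norm (M *v x) \<le> norm M * norm x * K"
    using bounded_bilinear.pos_bounded[OF bounded_bilinear_matrix_vector_mult] by blast
  obtain B where B: "B > 0" "\<And>M. M \<in> \<M> \<Longrightarrow> norm M \<le> B"
    using assms by (auto simp: bounded_pos)
  show ?thesis
  proof (intro exI[of _ "B * K"] conjI ballI allI)
    fix M x assume M: "M \<in> \<M>"
    have "quad M x \<le> norm x * norm (M *v x)"
      unfolding quad_def by (rule norm_cauchy_schwarz)
    also have "\<dots> \<le> norm x * (B * norm x * K)"
      using B(1) B(2)[OF M] K(1)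
      by (intro mult_left_mono) (auto intro!: order_trans[OF K(2)] mult_mono)
    finally show "quad M x \<le> B * K * (norm x)\<^sup>2"
      by (simp add: power2_eq_square mult_ac)
  qed (use K B in auto)
qed

text \<open>Scaling reduces to unit vectors, and a positive continuous function on the product of two
  compact sets has a positive minimum.\<close>

lemma compact_imp_uniformly_pos_def:
  fixes F :: "'a::metric_space \<Rightarrow> real^'n^'n"
  assumes "compact X" "continuous_on X F" "\<And>p. p \<in> X \<Longrightarrow> pos_def (F p)"
  shows "\<exists>c>0. \<forall>p\<in>X. \<forall>x. c * (norm x)\<^sup>2 \<le> quad (F p) x"
proof (cases "X = {}")
  case False
  let ?K = "X \<times> sphere (0::real^'n) 1"
  have "compact ?K"
    using assms(1) by (intro compact_Times) auto
  moreover have "sphere (0::real^'n) 1 \<noteq> {}"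
    by simp
  with False have "?K \<noteq> {}"
    by blast
  moreover have "continuous_on ?K (\<lambda>z. quad (F (fst z)) (snd z))"
    unfolding quad_def
    by (intro continuous_intros continuous_on_compose2[OF assms(2)]) auto
  ultimately obtain z where z: "z \<in> ?K"
      "\<forall>y\<in>?K. quad (F (fst z)) (snd z) \<le> quad (F (fst y)) (snd y)"
    using continuous_attains_inf by blast
  define c where "c = quad (F (fst z)) (snd z)"
  have "snd z \<noteq> 0"
    using z(1) by auto
  then have "c > 0"
    using z(1) assms(3)[of "fst z"] by (auto simp: c_def quad_def pos_def_def)
  moreover have "c * (norm x)\<^sup>2 \<le> quad (F p) x" if p: "p \<in> X" for p x
  proof (cases "x = 0")
    case False
    define u where "u = x /\<^sub>R norm x"
    have "(p, u) \<in> ?K"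
      using False p by (simp add: u_def)
    then have "c \<le> quad (F p) u"
      using z(2) by (force simp: c_def)
    moreover have "quad (F p) x = quad (F p) u * (norm x)\<^sup>2"
      using False by (simp add: quad_def u_def matrix_vector_mult_scaleR power2_eq_square field_simps)
    ultimately show ?thesis
      by (simp add: mult_right_mono)
  qed (simp add: quad_def)
  ultimately show ?thesis
    by blast
qed (auto intro: exI[of _ 1])

text \<open>As \<open>M s\<close> is symmetric, moving either of the two arguments \<open>x s\<close> contributes the same amount,
  and the two contributions add up to the form of \<open>Sym (M s ** B)\<close>.\<close>

lemma quad_has_derivative_along_linear_ode:
  assumes M: "(M has_vector_derivative M') (at s)" and sym: "transpose (M s) = M s"
    and x: "(x has_vector_derivative B *v x s) (at s)"
  shows "((\<lambda>s. quad (M s) (x s)) has_real_derivative quad (M' + Sym (M s ** B)) (x s)) (at s)"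
proof -
  note bb = bounded_bilinear.has_vector_derivative[OF bounded_bilinear_matrix_vector_mult M x]
  have "((\<lambda>s. quad (M s) (x s)) has_vector_derivative
      x s \<bullet> (M s *v (B *v x s) + M' *v x s) + (B *v x s) \<bullet> (M s *v x s)) (at s)"
    unfolding quad_def
    by (rule bounded_bilinear.has_vector_derivative[OF bounded_bilinear_inner x bb])
  moreover have "(B *v x s) \<bullet> (M s *v x s) = x s \<bullet> (M s *v (B *v x s))"
    using inner_transpose_matrix_vector[of "x s" "M s" "B *v x s"] sym
    by (simp add: inner_commute del: transpose_matrix_vector)
  ultimately show ?thesis
    by (simp add: has_real_derivative_iff_has_vector_derivative quad_add quad_Sym)
       (simp add: quad_def inner_add_right matrix_vector_mul_assoc algebra_simps)
qed

section \<open>Directional derivatives on a box\<close>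

text \<open>A box may lack interior points, so that \<open>F\<close> is differentiable relative to \<open>Y\<close> only and \<open>F'\<close>
  need not be unique; the chain rule holds for each choice of \<open>F'\<close> as long as the curve stays
  in \<open>Y\<close>.\<close>

lemma chain_rule_within:
  assumes "(F has_derivative F') (at (g s) within Y)"
    and "(g has_vector_derivative v) (at s within X)" and "g ` X \<subseteq> Y"
  shows "((\<lambda>s. F (g s)) has_vector_derivative F' v) (at s within X)"
proof -
  interpret F': bounded_linear F'
    using assms(1) by (rule has_derivative_bounded_linear)
  have "((\<lambda>s. F (g s)) has_derivative (\<lambda>h. F' (h *\<^sub>R v))) (at s within X)"
    using assms(2) has_derivative_subset[OF assms(1,3)]
    unfolding has_vector_derivative_def by (rule has_derivative_in_compose)
  then show ?thesis
    by (simp add: has_vector_derivative_def F'.scaleR)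
qed

text \<open>Degenerate coordinates, in which the box has no width, contribute nothing to the total
  derivative because the direction has no component there; in all others the one-sided partial
  derivative is determined by the relative Frechet derivative, as a nondegenerate interval
  accumulates at each of its points.\<close>

lemma derivative_within_box_eq_partials:
  fixes S :: "real \<Rightarrow> real^'p \<Rightarrow> real^'n^'n"
  assumes D: "((\<lambda>(\<tau>, \<theta>). S \<tau> \<theta>) has_derivative S') (at (\<tau>, \<theta>) within {0..T} \<times> cbox lo hi)"
    and T: "T > 0" and \<tau>: "\<tau> \<in> {0..T}" and \<theta>: "\<theta> \<in> cbox lo hi"
    and degenerate: "\<And>i. lo$i = hi$i \<Longrightarrow> \<mu>$i = 0"
  shows "S' (v, \<mu>) = v *\<^sub>R partial_tau T S \<tau> \<theta> + dir_partial_rho lo hi S \<tau> \<theta> \<mu>"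
proof -
  interpret S': bounded_linear S'
    using D by (rule has_derivative_bounded_linear)
  have "((\<lambda>s. (s, \<theta>)) has_vector_derivative (1, 0)) (at \<tau> within {0..T})"
    by (intro has_vector_derivative_Pair has_vector_derivative_id has_vector_derivative_const)
  from chain_rule_within[OF D this] \<theta>
  have "((\<lambda>s. S s \<theta>) has_vector_derivative S' (1, 0)) (at \<tau> within {0..T})"
    by auto
  then have tau: "partial_tau T S \<tau> \<theta> = S' (1, 0)"
    unfolding partial_tau_def using T \<tau> by (intro vector_derivative_within_closed_interval)
  have rho: "partial_rho lo hi S i \<tau> \<theta> = S' (0, axis i 1)" if i: "lo$i \<noteq> hi$i" for i
  proof -
    define g :: "real \<Rightarrow> real \<times> (real^'p)" where "g = (\<lambda>s. (\<tau>, \<chi> j. if j = i then s else \<theta>$j))"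
    have g: "g = (\<lambda>s. (\<tau>, \<theta> + (s - \<theta>$i) *\<^sub>R axis i 1))"
      by (auto simp: g_def fun_eq_iff vec_eq_iff axis_def)
    have g': "(g has_vector_derivative (0, axis i 1)) (at (\<theta>$i) within {lo$i..hi$i})"
      unfolding g by (auto intro!: derivative_eq_intros)
    have g_at: "g (\<theta>$i) = (\<tau>, \<theta>)"
      by (simp add: g)
    have g_box: "g ` {lo$i..hi$i} \<subseteq> {0..T} \<times> cbox lo hi"
      using \<tau> \<theta> by (auto simp: g_def mem_box_cart)
    from chain_rule_within[OF D[folded g_at] g' g_box]
    have S_deriv: "((\<lambda>s. S \<tau> (\<chi> j. if j = i then s else \<theta>$j)) has_vector_derivative S' (0, axis i 1))
        (at (\<theta>$i) within {lo$i..hi$i})"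
      by (simp only: g_def prod.case)
    have i_box: "lo$i \<le> \<theta>$i" "\<theta>$i \<le> hi$i"
      using \<theta> by (simp_all add: mem_box_cart)
    then have "lo$i < hi$i" "\<theta>$i \<in> {lo$i..hi$i}"
      using i by simp_all
    from vector_derivative_within_closed_interval[OF this S_deriv] show ?thesis
      using i by (simp only: partial_rho_def if_False)
  qed
  have "(v, \<mu>) = v *\<^sub>R (1, 0) + (\<Sum>i\<in>UNIV. \<mu>$i *\<^sub>R (0, axis i 1))"
    using basis_expansion[of \<mu>] by (simp add: prod_eq_iff fst_sum snd_sum scalar_mult_eq_scaleR)
  then have "S' (v, \<mu>) = v *\<^sub>R S' (1, 0) + (\<Sum>i\<in>UNIV. \<mu>$i *\<^sub>R S' (0, axis i 1))"
    by (simp only: S'.add S'.sum S'.scaleR)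
  also have "(\<Sum>i\<in>UNIV. \<mu>$i *\<^sub>R S' (0, axis i 1)) = dir_partial_rho lo hi S \<tau> \<theta> \<mu>"
    unfolding dir_partial_rho_def
  proof (rule sum.cong)
    fix i
    show "\<mu>$i *\<^sub>R S' (0, axis i 1) = \<mu>$i *\<^sub>R partial_rho lo hi S i \<tau> \<theta>"
      using rho[of i] degenerate[of i] by (cases "lo$i = hi$i") simp_all
  qed simp
  finally show ?thesis
    by (simp add: tau)
qed

text \<open>The quadratic form of the directional derivative is linear in the direction, so it is
  largest at the vertex picked by the signs of its coefficients.\<close>

lemma dir_partial_rho_le_vertex:
  fixes S :: "real \<Rightarrow> real^'p \<Rightarrow> real^'n^'n"
  assumes "\<mu> \<in> cbox \<nu>lo \<nu>hi"
  shows "\<exists>\<mu>'\<in>box_vertices \<nu>lo \<nu>hi.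
    quad (dir_partial_rho lo hi S \<tau> \<theta> \<mu>) x \<le> quad (dir_partial_rho lo hi S \<tau> \<theta> \<mu>') x"
proof
  let ?c = "\<lambda>i. quad (partial_rho lo hi S i \<tau> \<theta>) x"
  let ?\<mu>' = "\<chi> i. if ?c i \<ge> 0 then \<nu>hi$i else \<nu>lo$i"
  show "?\<mu>' \<in> box_vertices \<nu>lo \<nu>hi"
    by (auto simp: box_vertices_def)
  have "\<mu>$i * ?c i \<le> ?\<mu>'$i * ?c i" for i
    using assms by (auto simp: mem_box_cart intro: mult_right_mono mult_right_mono_neg)
  then show "quad (dir_partial_rho lo hi S \<tau> \<theta> \<mu>) x \<le> quad (dir_partial_rho lo hi S \<tau> \<theta> ?\<mu>') x"
    unfolding dir_partial_rho_def quad_sum quad_scaleR by (intro sum_mono)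
qed

section \<open>Dwell-time Lyapunov functions\<close>

text \<open>\<open>S\<close> is meant to be evaluated at the time since the last jump, capped at \<open>T\<close>, and at the current
  parameter.\<close>

locale dwell_time_lyapunov =
  fixes A :: "real^'p \<Rightarrow> real^'n^'n"
    and S :: "real \<Rightarrow> real^'p \<Rightarrow> real^'n^'n"
    and lo hi \<nu>lo \<nu>hi :: "real^'p"
    and T \<epsilon> :: real
  assumes T_pos: "T > 0"
    and \<epsilon>_pos: "\<epsilon> > 0"
    and S_pos_def: "\<And>\<tau> \<theta>. \<tau> \<in> {0..T} \<Longrightarrow> \<theta> \<in> cbox lo hi \<Longrightarrow> pos_def (S \<tau> \<theta>)"
    and S_C1: "continuously_differentiable_on (\<lambda>(\<tau>, \<theta>). S \<tau> \<theta>) ({0..T} \<times> cbox lo hi)"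
    and decrease_after_dwell: "\<And>\<theta> \<mu>. \<theta> \<in> cbox lo hi \<Longrightarrow> \<mu> \<in> box_vertices \<nu>lo \<nu>hi \<Longrightarrow>
      dir_partial_rho lo hi S T \<theta> \<mu> + Sym (S T \<theta> ** A \<theta>) + \<epsilon> *\<^sub>R mat 1 \<preceq> 0"
    and decrease_during_dwell:
      "\<And>\<tau> \<theta> \<mu>. \<tau> \<in> {0..T} \<Longrightarrow> \<theta> \<in> cbox lo hi \<Longrightarrow> \<mu> \<in> box_vertices \<nu>lo \<nu>hi \<Longrightarrow>
      partial_tau T S \<tau> \<theta> + dir_partial_rho lo hi S \<tau> \<theta> \<mu>
        + Sym (S \<tau> \<theta> ** A \<theta>) + \<epsilon> *\<^sub>R mat 1 \<preceq> 0"
    and decrease_at_jumps: "\<And>\<theta> \<eta>. \<theta> \<in> cbox lo hi \<Longrightarrow> \<eta> \<in> cbox lo hi \<Longrightarrow> S 0 \<theta> - S T \<eta> \<preceq> 0"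
begin

lemma S_continuous: "continuous_on ({0..T} \<times> cbox lo hi) (\<lambda>(\<tau>, \<theta>). S \<tau> \<theta>)"
proof -
  obtain S' where "\<And>p. p \<in> {0..T} \<times> cbox lo hi \<Longrightarrow>
      ((\<lambda>(\<tau>, \<theta>). S \<tau> \<theta>) has_derivative blinfun_apply (S' p)) (at p within {0..T} \<times> cbox lo hi)"
    using S_C1 unfolding continuously_differentiable_on_def by blast
  then show ?thesis
    by (rule has_derivative_continuous_on)
qed

lemma S_uniformly_continuous: "uniformly_continuous_on ({0..T} \<times> cbox lo hi) (\<lambda>(\<tau>, \<theta>). S \<tau> \<theta>)"
  by (rule compact_uniformly_continuous[OF S_continuous]) (intro compact_Times compact_Icc compact_cbox)

lemma ex_quad_bounds:
  "\<exists>c>0. \<forall>\<tau>\<in>{0..T}. \<forall>\<theta>\<in>cbox lo hi. \<forall>x. c * (norm x)\<^sup>2 \<le> quad (S \<tau> \<theta>) x"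
  "\<exists>C>0. \<forall>\<tau>\<in>{0..T}. \<forall>\<theta>\<in>cbox lo hi. \<forall>x. quad (S \<tau> \<theta>) x \<le> C * (norm x)\<^sup>2"
proof -
  have K: "compact ({0..T} \<times> cbox lo hi)"
    by (intro compact_Times compact_Icc compact_cbox)
  show "\<exists>c>0. \<forall>\<tau>\<in>{0..T}. \<forall>\<theta>\<in>cbox lo hi. \<forall>x. c * (norm x)\<^sup>2 \<le> quad (S \<tau> \<theta>) x"
    using compact_imp_uniformly_pos_def[OF K S_continuous] S_pos_def by auto
  have "bounded ((\<lambda>(\<tau>, \<theta>). S \<tau> \<theta>) ` ({0..T} \<times> cbox lo hi))"
    using K S_continuous by (intro compact_imp_bounded compact_continuous_image)
  from bounded_imp_quad_bound[OF this]
  show "\<exists>C>0. \<forall>\<tau>\<in>{0..T}. \<forall>\<theta>\<in>cbox lo hi. \<forall>x. quad (S \<tau> \<theta>) x \<le> C * (norm x)\<^sup>2"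
    by auto
qed

text \<open>Here \<open>v\<close> is the speed of the timer: it runs at speed \<open>1\<close> or rests at \<open>T\<close>.  This treats both
  phases of a dwell interval, and thus both matrix inequalities, at once.\<close>

lemma quad_rate_le:
  assumes \<tau>: "\<tau> \<in> {0..T}" and \<theta>: "\<theta> \<in> cbox lo hi" and \<mu>: "\<mu> \<in> cbox \<nu>lo \<nu>hi"
    and timer: "v = 1 \<or> v = 0 \<and> \<tau> = T"
  shows "quad (v *\<^sub>R partial_tau T S \<tau> \<theta> + dir_partial_rho lo hi S \<tau> \<theta> \<mu>
    + Sym (S \<tau> \<theta> ** A \<theta>)) x \<le> - \<epsilon> * (norm x)\<^sup>2"
proof -
  obtain \<mu>' where \<mu>': "\<mu>' \<in> box_vertices \<nu>lo \<nu>hi"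
      "quad (dir_partial_rho lo hi S \<tau> \<theta> \<mu>) x \<le> quad (dir_partial_rho lo hi S \<tau> \<theta> \<mu>') x"
    using dir_partial_rho_le_vertex[OF \<mu>] by blast
  have "v *\<^sub>R partial_tau T S \<tau> \<theta> + dir_partial_rho lo hi S \<tau> \<theta> \<mu>'
      + Sym (S \<tau> \<theta> ** A \<theta>) + \<epsilon> *\<^sub>R mat 1 \<preceq> 0"
    using timer decrease_during_dwell[OF \<tau> \<theta> \<mu>'(1)] decrease_after_dwell[OF \<theta> \<mu>'(1)] by auto
  from loewner_le_0_imp_quad_le_0[OF this, of x] \<mu>'(2) show ?thesis
    by (simp add: quad_add quad_scaleR quad_mat_1)
qed

text \<open>The rate bound \<open>- \<epsilon> |x|\<^sup>2\<close> is at most \<open>- \<epsilon> / C\<close> times the Lyapunov function, which the integrating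
  factor \<open>exp (\<epsilon> / C * s)\<close> absorbs.  The timer \<open>\<sigma>\<close> is a parameter so that the lemma serves both phases,
  which have to be treated separately because \<open>min (s - a) T\<close> has a kink at \<open>s = a + T\<close>.\<close>

lemma weighted_quad_decreasing:
  assumes C: "\<forall>\<tau>\<in>{0..T}. \<forall>\<theta>\<in>cbox lo hi. \<forall>x. quad (S \<tau> \<theta>) x \<le> C * (norm x)\<^sup>2" and "C > 0"
    and s: "open X" "s \<in> X"
    and \<sigma>: "(\<sigma> has_real_derivative v) (at s)" "\<sigma> ` X \<subseteq> {0..T}" "v = 1 \<or> v = 0 \<and> \<sigma> s = T"
    and \<rho>: "(\<rho> has_vector_derivative \<mu>) (at s)" "\<rho> ` X \<subseteq> cbox lo hi"
    and \<mu>: "\<mu> \<in> rate_set lo hi \<nu>lo \<nu>hi (\<rho> s)"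
    and x: "(x has_vector_derivative A (\<rho> s) *v x s) (at s)"
  shows "\<exists>D. ((\<lambda>s. exp (\<epsilon> / C * s) * quad (S (\<sigma> s) (\<rho> s)) (x s)) has_real_derivative D) (at s) \<and> D \<le> 0"
proof -
  have in_box: "\<sigma> s \<in> {0..T}" "\<rho> s \<in> cbox lo hi"
    using s \<sigma>(2) \<rho>(2) by auto
  obtain S' where S': "((\<lambda>(\<tau>, \<theta>). S \<tau> \<theta>) has_derivative S') (at (\<sigma> s, \<rho> s) within {0..T} \<times> cbox lo hi)"
    using S_C1 in_box unfolding continuously_differentiable_on_def by blast
  \<comment> \<open>In a coordinate without width both boundary conditions on the rate apply.\<close>
  have degenerate: "\<mu>$i = 0" if "lo$i = hi$i" for i
  proof -
    have "(\<rho> s)$i = lo$i"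
      using in_box(2) that unfolding mem_box_cart by (metis antisym)
    then show ?thesis
      using \<mu> that by (auto simp: rate_set_def intro: antisym)
  qed
  let ?W = "v *\<^sub>R partial_tau T S (\<sigma> s) (\<rho> s) + dir_partial_rho lo hi S (\<sigma> s) (\<rho> s) \<mu>"
  have "((\<lambda>s. (\<sigma> s, \<rho> s)) has_vector_derivative (v, \<mu>)) (at s within X)"
    using \<sigma>(1) \<rho>(1)
    by (auto intro!: has_vector_derivative_Pair simp: has_real_derivative_iff_has_vector_derivative
        intro: has_vector_derivative_at_within)
  from chain_rule_within[OF S' this] \<sigma>(2) \<rho>(2)
  have "((\<lambda>s. S (\<sigma> s) (\<rho> s)) has_vector_derivative S' (v, \<mu>)) (at s within X)"
    by auto
  moreover have "S' (v, \<mu>) = ?W"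
    by (intro derivative_within_box_eq_partials[OF S' T_pos in_box] degenerate)
  ultimately have "((\<lambda>s. S (\<sigma> s) (\<rho> s)) has_vector_derivative ?W) (at s)"
    by (simp only: at_within_open[OF s(2,1)])
  from quad_has_derivative_along_linear_ode[OF this _ x]
  have V': "((\<lambda>s. quad (S (\<sigma> s) (\<rho> s)) (x s)) has_real_derivative
      quad (?W + Sym (S (\<sigma> s) (\<rho> s) ** A (\<rho> s))) (x s)) (at s)" (is "(_ has_real_derivative ?V') _")
    using S_pos_def[OF in_box] by (simp add: pos_def_def)
  let ?V = "quad (S (\<sigma> s) (\<rho> s)) (x s)"
  have "?V' \<le> - \<epsilon> * (norm (x s))\<^sup>2"
    using quad_rate_le[OF in_box _ \<sigma>(3)] \<mu> by (simp add: rate_set_def)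
  moreover have "\<epsilon> / C * ?V \<le> \<epsilon> / C * (C * (norm (x s))\<^sup>2)"
    using C in_box \<epsilon>_pos \<open>C > 0\<close> by (intro mult_left_mono) auto
  ultimately have "\<epsilon> / C * ?V + ?V' \<le> 0"
    using \<open>C > 0\<close> by simp
  then have "exp (\<epsilon> / C * s) * (\<epsilon> / C * ?V + ?V') \<le> 0"
    by (intro mult_nonneg_nonpos) auto
  moreover have "((\<lambda>s. exp (\<epsilon> / C * s) * quad (S (\<sigma> s) (\<rho> s)) (x s)) has_real_derivative
      exp (\<epsilon> / C * s) * (\<epsilon> / C * ?V + ?V')) (at s)"
    by (rule derivative_eq_intros V' refl | simp add: algebra_simps)+
  ultimately show ?thesis
    by blast
qed

text \<open>The derivative bounds hold only to the right of the switching time \<open>a\<close>, where \<open>\<rho>\<close> may jump, so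
  the value at \<open>a\<close> has to be linked to those just after it: by uniform continuity \<open>S (s - a) (\<rho> s)\<close> is close to
  \<open>S 0 (\<rho> s)\<close> for \<open>s\<close> near \<open>a\<close>, and the jump condition bounds the latter by \<open>S T (\<rho> a)\<close>, whatever
  \<open>\<rho> s\<close> is.\<close>

lemma decay_on_dwell_interval:
  assumes C: "\<forall>\<tau>\<in>{0..T}. \<forall>\<theta>\<in>cbox lo hi. \<forall>x. quad (S \<tau> \<theta>) x \<le> C * (norm x)\<^sup>2" and "C > 0"
    and dwell: "a + T \<le> b"
    and \<rho>_box: "\<And>s. s \<in> {a..b} \<Longrightarrow> \<rho> s \<in> cbox lo hi"
    and \<rho>_left: "continuous (at_left b) \<rho>"
    and \<rho>': "\<And>s. s \<in> {a<..<b} \<Longrightarrow>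
      \<exists>\<mu>\<in>rate_set lo hi \<nu>lo \<nu>hi (\<rho> s). (\<rho> has_vector_derivative \<mu>) (at s)"
    and x_cont: "continuous_on {a..b} x"
    and x': "\<And>s. s \<in> {a<..<b} \<Longrightarrow> (x has_vector_derivative A (\<rho> s) *v x s) (at s)"
    and s0: "s0 \<in> {a<..b}"
  shows "exp (\<epsilon> / C * s0) * quad (S (min (s0 - a) T) (\<rho> s0)) (x s0)
    \<le> exp (\<epsilon> / C * a) * quad (S T (\<rho> a)) (x a)"
proof -
  define U where "U s = exp (\<epsilon> / C * s) * quad (S (min (s - a) T) (\<rho> s)) (x s)" for s
  have "continuous_on {a<..b} \<rho>"
    unfolding continuous_on_eq_continuous_within
  proof
    fix s assume s: "s \<in> {a<..b}"
    show "continuous (at s within {a<..b}) \<rho>"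
    proof (cases "s = b")
      case True
      have "at b within {a<..b} \<le> at_left b"
        unfolding at_within_def by (intro inf_mono) auto
      moreover have "(\<rho> \<longlongrightarrow> \<rho> b) (at_left b)"
        using \<rho>_left by (simp only: continuous_within)
      ultimately show ?thesis
        unfolding True continuous_within by (rule tendsto_mono)
    next
      case False
      then have "s \<in> {a<..<b}"
        using s by auto
      from \<rho>'[OF this] show ?thesis
        by (meson continuous_at_imp_continuous_at_within has_vector_derivative_continuous)
    qed
  qed
  then have "continuous_on {a<..b} (\<lambda>s. (min (s - a) T, \<rho> s))"
    by (intro continuous_intros)
  then have "continuous_on {a<..b} (\<lambda>s. case (min (s - a) T, \<rho> s) of (\<tau>, \<theta>) \<Rightarrow> S \<tau> \<theta>)"
    using \<rho>_box T_pos by (intro continuous_on_compose2[OF S_continuous]) auto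
  then have S_cont: "continuous_on {a<..b} (\<lambda>s. S (min (s - a) T) (\<rho> s))"
    by simp
  have U_cont: "continuous_on {a<..b} U"
    unfolding U_def quad_def
    by (intro continuous_intros S_cont continuous_on_subset[OF x_cont]) auto
  have U_mono_phase: "U r \<le> U s"
    if "a < s" "s \<le> r" "r \<le> b" and phase: "r \<le> a + T \<or> a + T \<le> s" for s r
  proof (rule DERIV_nonpos_imp_decreasing_open[OF \<open>s \<le> r\<close>])
    show "continuous_on {s..r} U"
      using U_cont that by (auto elim: continuous_on_subset)
    fix q assume q: "s < q" "q < r"
    let ?\<sigma> = "\<lambda>q. if r \<le> a + T then q - a else T"
    let ?v = "if r \<le> a + T then 1 else 0 :: real"
    have q': "q \<in> {a<..<b}"
      using that q by auto
    obtain \<mu> where \<mu>: "\<mu> \<in> rate_set lo hi \<nu>lo \<nu>hi (\<rho> q)" "(\<rho> has_vector_derivative \<mu>) (at q)"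
      using \<rho>'[OF q'] by blast
    have "\<exists>D. ((\<lambda>q. exp (\<epsilon> / C * q) * quad (S (?\<sigma> q) (\<rho> q)) (x q)) has_real_derivative D) (at q) \<and> D \<le> 0"
    proof (rule weighted_quad_decreasing[OF C \<open>C > 0\<close>, where X = "{s<..<r}" and v = ?v and \<mu> = \<mu>])
      show "(?\<sigma> has_real_derivative ?v) (at q)"
        by (auto intro!: derivative_eq_intros)
    next
      show "\<rho> ` {s<..<r} \<subseteq> cbox lo hi"
        using that \<rho>_box by auto
    next
      show "?\<sigma> ` {s<..<r} \<subseteq> {0..T}"
        using \<open>a < s\<close> T_pos by (cases "r \<le> a + T") (simp_all add: image_subset_iff)
    next
      show "?v = 1 \<or> ?v = 0 \<and> ?\<sigma> q = T"
        by simp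
    qed (use q \<mu> x'[OF q'] in simp_all)
    then obtain D where D: "((\<lambda>q. exp (\<epsilon> / C * q) * quad (S (?\<sigma> q) (\<rho> q)) (x q)) has_real_derivative D) (at q)"
        "D \<le> 0"
      by blast
    moreover have "(U has_real_derivative D) (at q)"
    proof (rule has_field_derivative_transform_within_open[OF D(1), where S = "{s<..<r}"])
      fix p assume "p \<in> {s<..<r}"
      then have "?\<sigma> p = min (p - a) T"
        using phase by auto
      then show "exp (\<epsilon> / C * p) * quad (S (?\<sigma> p) (\<rho> p)) (x p) = U p"
        by (simp only: U_def)
    qed (use q in auto)
    ultimately show "\<exists>D. (U has_real_derivative D) (at q) \<and> D \<le> 0"
      by blast
  qed
  \<comment> \<open>At the kink \<open>a + T\<close> of the timer the two phases are joined.\<close>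
  have U_mono: "U r \<le> U s" if "a < s" "s \<le> r" "r \<le> b" for s r
  proof (cases "r \<le> a + T \<or> a + T \<le> s")
    case False
    then have "U r \<le> U (a + T)" "U (a + T) \<le> U s"
      using that by (auto intro!: U_mono_phase)
    then show ?thesis
      by linarith
  qed (use that U_mono_phase in blast)
  \<comment> \<open>\<open>h\<close> bounds \<open>U\<close> just after the jump and tends to the weighted value at the jump.\<close>
  define h where "h s = exp (\<epsilon> / C * s) *
    (quad (S T (\<rho> a)) (x s) + quad (S (s - a) (\<rho> s) - S 0 (\<rho> s)) (x s))" for s
  define e where "e = min s0 (a + T)"
  have e: "a < e" "e \<le> s0" "e \<le> a + T"
    using s0 T_pos by (auto simp: e_def)
  have near: "\<forall>\<^sub>F s in at_right a. s \<in> {a<..<e}"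
    using e(1) by (rule eventually_at_right_real)
  have "U s0 \<le> h s" if s: "s \<in> {a<..<e}" for s
  proof -
    have "quad (S 0 (\<rho> s) - S T (\<rho> a)) (x s) \<le> 0"
      using s s0 e \<rho>_box by (intro loewner_le_0_imp_quad_le_0 decrease_at_jumps) auto
    then have "U s \<le> h s"
      using s e by (simp add: U_def h_def quad_diff)
    moreover have "U s0 \<le> U s"
      using s s0 e by (intro U_mono) auto
    ultimately show ?thesis
      by linarith
  qed
  with near have U_le_h: "\<forall>\<^sub>F s in at_right a. U s0 \<le> h s"
    by (auto elim: eventually_mono)
  have "((\<lambda>s. S (s - a) (\<rho> s) - S 0 (\<rho> s)) \<longlongrightarrow> 0) (at_right a)"
    unfolding tendsto_iff
  proof (intro allI impI)
    fix \<delta> :: real assume "\<delta> > 0"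
    with S_uniformly_continuous obtain d where "d > 0" and d: "\<forall>p\<in>{0..T} \<times> cbox lo hi.
        \<forall>q\<in>{0..T} \<times> cbox lo hi. dist q p < d \<longrightarrow>
          dist (case q of (\<tau>, \<theta>) \<Rightarrow> S \<tau> \<theta>) (case p of (\<tau>, \<theta>) \<Rightarrow> S \<tau> \<theta>) < \<delta>"
      unfolding uniformly_continuous_on_def by blast
    have "\<forall>\<^sub>F s in at_right a. s \<in> {a<..<a + d}"
      using \<open>d > 0\<close> by (intro eventually_at_right_real) auto
    with near show "\<forall>\<^sub>F s in at_right a. dist (S (s - a) (\<rho> s) - S 0 (\<rho> s)) 0 < \<delta>"
    proof eventually_elim
      case (elim s)
      with e s0 \<rho>_box T_pos have "(s - a, \<rho> s) \<in> {0..T} \<times> cbox lo hi" "(0, \<rho> s) \<in> {0..T} \<times> cbox lo hi"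
        by auto
      from d[rule_format, OF this(2,1)] elim show ?case
        by (simp add: dist_Pair_Pair dist_norm)
    qed
  qed
  moreover have "(x \<longlongrightarrow> x a) (at_right a)"
    using continuous_on_Icc_at_rightD[OF x_cont] s0 by simp
  ultimately have "(h \<longlongrightarrow> exp (\<epsilon> / C * a) * (quad (S T (\<rho> a)) (x a) + quad 0 (x a))) (at_right a)"
    unfolding h_def quad_def by (intro tendsto_intros)
  from tendsto_lowerbound[OF this U_le_h] show ?thesis
    by (simp add: U_def quad_zero)
qed

text \<open>The switching times grow at least linearly and therefore cannot accumulate.\<close>

lemma ex_switching_interval:
  assumes "t 0 = 0" and "\<And>k. T \<le> t (Suc k) - t k" and "s > (0::real)"
  shows "\<exists>k. s \<in> {t k<..t (Suc k)}"
proof -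
  have lower: "real k * T \<le> t k" for k
  proof (induction k)
    case (Suc k)
    then show ?case
      using assms(2)[of k] by (simp add: algebra_simps)
  qed (use assms(1) in simp)
  obtain m where "s < real m * T"
    using reals_Archimedean3[OF T_pos] by blast
  with lower have ex: "\<exists>k. s \<le> t k"
    by (meson less_le_trans less_imp_le)
  define k where "k = (LEAST k. s \<le> t k)"
  have "s \<le> t k"
    unfolding k_def using ex by (rule LeastI_ex)
  moreover have "k \<noteq> 0"
    using \<open>s \<le> t k\<close> assms by (intro notI) simp
  then obtain j where j: "k = Suc j"
    using not0_implies_Suc by blast
  moreover have "\<not> s \<le> t j"
    using not_less_Least[of j "\<lambda>k. s \<le> t k"] j by (simp add: k_def)
  ultimately show ?thesis
    using \<open>s \<le> t k\<close> by (intro exI[of _ j]) auto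
qed

text \<open>At a positive switching time the timer has the value \<open>T\<close>, since the preceding interval has length
  at least \<open>T\<close>.  So the bound at the right end of one interval is the one needed at the left end of
  the next, and at time \<open>0\<close> the estimate starts with \<open>S T (\<rho> 0)\<close> as if there were a jump.\<close>

lemma solution_decays_exponentially:
  assumes C: "\<forall>\<tau>\<in>{0..T}. \<forall>\<theta>\<in>cbox lo hi. \<forall>x. quad (S \<tau> \<theta>) x \<le> C * (norm x)\<^sup>2" and "C > 0"
    and c: "\<forall>\<tau>\<in>{0..T}. \<forall>\<theta>\<in>cbox lo hi. \<forall>x. c * (norm x)\<^sup>2 \<le> quad (S \<tau> \<theta>) x" and "c > 0"
    and sol: "lpv_solution A (has_switching_times T lo hi \<nu>lo \<nu>hi) \<rho> x0 x" and "s \<ge> 0"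
  shows "c * (norm (x s))\<^sup>2 \<le> C * exp (- (\<epsilon> / C * s)) * (norm x0)\<^sup>2"
proof -
  from sol obtain t where x0: "x 0 = x0" and x_cont: "continuous_on {0..} x"
      and t: "has_switching_times T lo hi \<nu>lo \<nu>hi \<rho> t"
      and x': "\<And>s. s \<ge> 0 \<Longrightarrow> s \<notin> range t \<Longrightarrow> (x has_vector_derivative A (\<rho> s) *v x s) (at s)"
    unfolding lpv_solution_def by blast
  from t have t0: "t 0 = 0" and t_mono: "strict_mono t" and dwell: "\<And>k. T \<le> t (Suc k) - t k"
      and \<rho>_box: "\<And>s. s \<ge> 0 \<Longrightarrow> \<rho> s \<in> cbox lo hi"
      and \<rho>_left: "\<And>s. s > 0 \<Longrightarrow> continuous (at_left s) \<rho>"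
      and \<rho>': "\<And>k s. s \<in> {t k<..<t (Suc k)} \<Longrightarrow>
        \<exists>\<mu>\<in>rate_set lo hi \<nu>lo \<nu>hi (\<rho> s). (\<rho> has_vector_derivative \<mu>) (at s)"
    unfolding has_switching_times_def by auto
  have t_nonneg: "t k \<ge> 0" for k
    using strict_mono_less_eq[OF t_mono, of 0 k] t0 by simp
  have not_switching: "s \<notin> range t" if "s \<in> {t k<..<t (Suc k)}" for s k
  proof
    assume "s \<in> range t"
    then obtain j where "s = t j"
      by blast
    then show False
      using that strict_mono_less[OF t_mono] by auto
  qed
  have decay: "exp (\<epsilon> / C * s) * quad (S (min (s - t k) T) (\<rho> s)) (x s)
      \<le> exp (\<epsilon> / C * t k) * quad (S T (\<rho> (t k))) (x (t k))" if s: "s \<in> {t k<..t (Suc k)}" for s k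
  proof (rule decay_on_dwell_interval[OF C \<open>C > 0\<close> _ _ _ _ _ _ s])
    show "t k + T \<le> t (Suc k)"
      using dwell[of k] by linarith
    show "continuous (at_left (t (Suc k))) \<rho>"
      using s t_nonneg[of k] by (intro \<rho>_left) auto
    show "continuous_on {t k..t (Suc k)} x"
      using t_nonneg[of k] by (intro continuous_on_subset[OF x_cont]) auto
    show "(x has_vector_derivative A (\<rho> r) *v x r) (at r)" if "r \<in> {t k<..<t (Suc k)}" for r
      using that t_nonneg[of k] by (intro x' not_switching) auto
    show "\<exists>\<mu>\<in>rate_set lo hi \<nu>lo \<nu>hi (\<rho> r). (\<rho> has_vector_derivative \<mu>) (at r)"
      if "r \<in> {t k<..<t (Suc k)}" for r
      using that by (rule \<rho>')
    show "\<rho> r \<in> cbox lo hi" if "r \<in> {t k..t (Suc k)}" for r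
      using that t_nonneg[of k] by (intro \<rho>_box) auto
  qed
  have initial: "quad (S T (\<rho> 0)) x0 \<le> C * (norm x0)\<^sup>2"
    using C \<rho>_box[of 0] T_pos by auto
  have at_switching: "exp (\<epsilon> / C * t k) * quad (S T (\<rho> (t k))) (x (t k)) \<le> C * (norm x0)\<^sup>2" for k
  proof (induction k)
    case 0
    then show ?case
      using initial by (simp add: t0 x0)
  next
    case (Suc k)
    have "min (t (Suc k) - t k) T = T" "t (Suc k) \<in> {t k<..t (Suc k)}"
      using dwell[of k] T_pos by auto
    with decay[of "t (Suc k)" k] Suc.IH show ?case
      by simp
  qed
  have "exp (\<epsilon> / C * s) * (c * (norm (x s))\<^sup>2) \<le> C * (norm x0)\<^sup>2"
  proof (cases "s = 0")
    case True
    have "c * (norm x0)\<^sup>2 \<le> quad (S T (\<rho> 0)) x0"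
      using c \<rho>_box[of 0] T_pos by auto
    with initial True show ?thesis
      by (simp add: x0)
  next
    case False
    with \<open>s \<ge> 0\<close> obtain k where k: "s \<in> {t k<..t (Suc k)}"
      using ex_switching_interval[OF t0 dwell, of s] by auto
    have "exp (\<epsilon> / C * s) * (c * (norm (x s))\<^sup>2) \<le> exp (\<epsilon> / C * s) * quad (S (min (s - t k) T) (\<rho> s)) (x s)"
      using c \<rho>_box[OF \<open>s \<ge> 0\<close>] k T_pos by (intro mult_left_mono) auto
    also have "\<dots> \<le> C * (norm x0)\<^sup>2"
      using decay[OF k] at_switching[of k] by linarith
    finally show ?thesis .
  qed
  then show ?thesis
    by (simp add: exp_minus field_simps)
qed

lemma asymptotically_stable:
  "lpv_asymptotically_stable A (has_switching_times T lo hi \<nu>lo \<nu>hi)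
    (dwell_time_trajectories T lo hi \<nu>lo \<nu>hi)"
proof -
  let ?sw = "has_switching_times T lo hi \<nu>lo \<nu>hi"
  obtain c where c: "c > 0" "\<forall>\<tau>\<in>{0..T}. \<forall>\<theta>\<in>cbox lo hi. \<forall>x. c * (norm x)\<^sup>2 \<le> quad (S \<tau> \<theta>) x"
    using ex_quad_bounds(1) by blast
  obtain C where C: "C > 0" "\<forall>\<tau>\<in>{0..T}. \<forall>\<theta>\<in>cbox lo hi. \<forall>x. quad (S \<tau> \<theta>) x \<le> C * (norm x)\<^sup>2"
    using ex_quad_bounds(2) by blast
  define M where "M = sqrt (C / c)"
  \<comment> \<open>The factor \<open>2\<close> comes from taking the square root of the quadratic estimate.\<close>
  define r where "r = \<epsilon> / (2 * C)"
  have "M > 0" "r > 0"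
    using c(1) C(1) \<epsilon>_pos by (auto simp: M_def r_def)
  have decay: "norm (x s) \<le> M * exp (- r * s) * norm x0"
    if "lpv_solution A ?sw \<rho> x0 x" "s \<ge> 0" for \<rho> x0 x s
  proof (rule power2_le_imp_le)
    have "(exp (- r * s))\<^sup>2 = exp (- (\<epsilon> / C * s))"
      by (simp add: r_def flip: exp_double)
    moreover have "(norm (x s))\<^sup>2 \<le> C / c * exp (- (\<epsilon> / C * s)) * (norm x0)\<^sup>2"
      using solution_decays_exponentially[OF C(2,1) c(2,1) that] c(1) by (simp add: field_simps)
    ultimately show "(norm (x s))\<^sup>2 \<le> (M * exp (- r * s) * norm x0)\<^sup>2"
      using c(1) C(1) by (simp add: M_def power_mult_distrib)
  qed (use \<open>M > 0\<close> in simp)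
  show ?thesis
    unfolding lpv_asymptotically_stable_def
  proof (intro conjI exI[of _ "\<lambda>y. M * y"] ballI allI impI)
    show "class_K_infinity (\<lambda>y. M * y)"
      unfolding class_K_infinity_def using \<open>M > 0\<close>
      by (auto intro!: continuous_intros strict_mono_onI
          filterlim_tendsto_pos_mult_at_top[OF tendsto_const _ filterlim_ident])
  next
    fix \<rho> x0 x and s :: real
    assume "lpv_solution A ?sw \<rho> x0 x" "s \<ge> 0"
    from decay[OF this] have "norm (x s) \<le> M * exp (- r * s) * norm x0" .
    also have "\<dots> \<le> M * 1 * norm x0"
      using \<open>M > 0\<close> \<open>r > 0\<close> \<open>s \<ge> 0\<close> by (intro mult_right_mono mult_left_mono) auto
    finally show "norm (x s) \<le> M * norm x0"
      by simp
  next
    fix R \<delta> :: real assume "R > 0" "\<delta> > 0"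
    have "((\<lambda>s. M * exp (- r * s) * R) \<longlongrightarrow> M * 0 * R) at_top"
      using \<open>r > 0\<close>
      by (intro tendsto_intros filterlim_compose[OF exp_at_bot]
          filterlim_tendsto_neg_mult_at_bot[OF tendsto_const _ filterlim_ident]) auto
    then have "\<forall>\<^sub>F s in at_top. M * exp (- r * s) * R < \<delta>"
      using \<open>\<delta> > 0\<close> by (intro order_tendstoD) auto
    then obtain N where N: "\<And>s. s \<ge> N \<Longrightarrow> M * exp (- r * s) * R < \<delta>"
      by (auto simp: eventually_at_top_linorder)
    show "\<exists>tstar\<ge>0. \<forall>\<rho>\<in>dwell_time_trajectories T lo hi \<nu>lo \<nu>hi. \<forall>x0 x. norm x0 \<le> R \<longrightarrow>
        lpv_solution A ?sw \<rho> x0 x \<longrightarrow> (\<forall>t\<ge>tstar. norm (x t) \<le> \<delta>)"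
    proof (intro exI[of _ "max 0 N"] conjI ballI allI impI)
      fix \<rho> x0 x s
      assume x0: "norm x0 \<le> R" and sol: "lpv_solution A ?sw \<rho> x0 x" and s: "max 0 N \<le> s"
      have "norm (x s) \<le> M * exp (- r * s) * norm x0"
        using decay[OF sol] s by simp
      also have "\<dots> \<le> M * exp (- r * s) * R"
        using x0 \<open>M > 0\<close> by (intro mult_left_mono) auto
      also have "\<dots> \<le> \<delta>"
        using N[of s] s by simp
      finally show "norm (x s) \<le> \<delta>" .
    qed simp
  qed
qed

end

section \<open>Asymptotic stability under a minimal dwell time\<close>

theorem theorem3:
  fixes A :: "real^'p \<Rightarrow> real^'n^'n"
    and S :: "real \<Rightarrow> real^'p \<Rightarrow> real^'n^'n"
    and lo hi \<nu>lo \<nu>hi :: "real^'p"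
    and T \<epsilon> :: real
  assumes "\<forall>i. lo$i \<le> hi$i"
    and "\<forall>i. \<nu>lo$i \<le> \<nu>hi$i"
    and "bounded (A ` cbox lo hi)"
    and "continuous_on (cbox lo hi) A"
    and "T > 0"
    and "\<epsilon> > 0"
    and "\<forall>\<tau>\<in>{0..T}. \<forall>\<theta>\<in>cbox lo hi. pos_def (S \<tau> \<theta>)"
    and "bounded ((\<lambda>(\<tau>, \<theta>). S \<tau> \<theta>) ` ({0..T} \<times> cbox lo hi))"
    and "continuously_differentiable_on (\<lambda>(\<tau>, \<theta>). S \<tau> \<theta>) ({0..T} \<times> cbox lo hi)"
    and "\<forall>\<theta>\<in>cbox lo hi. \<forall>\<mu>\<in>box_vertices \<nu>lo \<nu>hi.
      dir_partial_rho lo hi S T \<theta> \<mu> + Sym (S T \<theta> ** A \<theta>) + \<epsilon> *\<^sub>R mat 1 \<preceq> 0"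
    and "\<forall>\<tau>\<in>{0..T}. \<forall>\<theta>\<in>cbox lo hi. \<forall>\<mu>\<in>box_vertices \<nu>lo \<nu>hi.
      partial_tau T S \<tau> \<theta> + dir_partial_rho lo hi S \<tau> \<theta> \<mu>
        + Sym (S \<tau> \<theta> ** A \<theta>) + \<epsilon> *\<^sub>R mat 1 \<preceq> 0"
    and "\<forall>\<theta>\<in>cbox lo hi. \<forall>\<eta>\<in>cbox lo hi. S 0 \<theta> - S T \<eta> \<preceq> 0"
  shows "lpv_asymptotically_stable A (has_switching_times T lo hi \<nu>lo \<nu>hi)
    (dwell_time_trajectories T lo hi \<nu>lo \<nu>hi)"
proof -
  interpret dwell_time_lyapunov A S lo hi \<nu>lo \<nu>hi T \<epsilon>
  proof unfold_locales
    show "T > 0" "\<epsilon> > 0"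
      by fact+
    show "continuously_differentiable_on (\<lambda>(\<tau>, \<theta>). S \<tau> \<theta>) ({0..T} \<times> cbox lo hi)"
      by fact
  qed (rule assms(7,10-12)[rule_format]; assumption)+
  show ?thesis
    by (rule asymptotically_stable)
qed

end
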